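(* Let $\lambda$ be a positive Borel measure on an interval $(a,b)\subset\mathbb R$ with infinite support and such that all moments exist, let $\mathcal L[f]=\int_a^b f\,d\lambda$ for real polynomials $f$, let $P_n$ be the monic orthogonal polynomials with respect to $(f,g)=\mathcal L[f\cdot g]$, let $\sigma_n=1/\|P_n\|$ and $\tilde P_n=\sigma_nP_n$, and let $x_{n,1},\dots,x_{n,n}$ be the zeros of $P_n$. Let $0<\varepsilon\ll 1$, $s\in\{1,\dots,n-1\}$, and let $\gamma_{n,1},\dots,\gamma_{n,s}$ be real numbers with $|\gamma_{n,k}-x_{n,k}|<\varepsilon$ for $k=1,\dots,s$. Then the polynomial $$Q_n(x)=\sigma_n\prod_{i=1}^s (x-\gamma_{n,i})\prod_{i=s+1}^n (x-x_{n,i})$$ is almost orthogonal with respect to $\{\tilde P_k(x)\}_{k=0}^n$, i.e. $$f_i=\mathcal L\bigl[\tilde P_i\,Q_n\bigr]=\begin{cases}\varepsilon\,\omega_i, & 0\le i\le n-1,\\ 1, & i=n,\end{cases}\qquad(\omega_i\in\mathbb R,\ 0\le i\le n-1).$$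
   Context: $\|f\|=\sqrt{\mathcal L[f^2]}$. The $P_n$ ($n\ge 0$) are the monic polynomials with $\deg P_n=n$ and $\mathcal L[P_mP_n]=0$ for $m\ne n$; the $\tilde P_n$ are the corresponding orthonormal polynomials. The zeros of $P_n$ are all contained in $(a,b)$, and $P_n(x)=\prod_{k=1}^n(x-x_{n,k})$. *)

theory Defs
  imports "HOL-Analysis.Analysis" "HOL-Computational_Algebra.Polynomial"
begin

text \<open>The endpoints are extended reals, so bounded and unbounded intervals are both covered.
  The measure lives on the Borel subsets of the interval; no finiteness is required.\<close>

definition borel_measure_on :: "ereal \<Rightarrow> ereal \<Rightarrow> real measure \<Rightarrow> bool" where
  "borel_measure_on a b M \<longleftrightarrow> a < b \<and> sets M = sets (restrict_space borel (einterval a b))"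

definition msupport :: "'a::topological_space measure \<Rightarrow> 'a set" where
  "msupport M = {t \<in> space M. \<forall>U. open U \<longrightarrow> t \<in> U \<longrightarrow> emeasure M (U \<inter> space M) > 0}"

definition moments_exist :: "real measure \<Rightarrow> bool" where
  "moments_exist M \<longleftrightarrow> (\<forall>k::nat. integrable M (\<lambda>t. t ^ k))"

definition Lfun :: "real measure \<Rightarrow> real poly \<Rightarrow> real" where
  "Lfun M f = (\<integral>t. poly f t \<partial>M)"

definition Lnorm :: "real measure \<Rightarrow> real poly \<Rightarrow> real" where
  "Lnorm M f = sqrt (Lfun M (f ^ 2))"

definition monic_orthogonal :: "real measure \<Rightarrow> (nat \<Rightarrow> real poly) \<Rightarrow> bool" where
  "monic_orthogonal M P \<longleftrightarrow>
     (\<forall>n. degree (P n) = n \<and> lead_coeff (P n) = 1) \<and>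
     (\<forall>m n. m \<noteq> n \<longrightarrow> Lfun M (P m * P n) = 0)"

definition sigma :: "real measure \<Rightarrow> (nat \<Rightarrow> real poly) \<Rightarrow> nat \<Rightarrow> real" where
  "sigma M P n = 1 / Lnorm M (P n)"

definition Ptilde :: "real measure \<Rightarrow> (nat \<Rightarrow> real poly) \<Rightarrow> nat \<Rightarrow> real poly" where
  "Ptilde M P n = smult (sigma M P n) (P n)"

text \<open>Only the values of \<open>\<gamma>\<close> on \<open>{1..s}\<close> and of \<open>x\<close> on \<open>{s+1..n}\<close> matter.\<close>

definition Qpoly :: "real measure \<Rightarrow> (nat \<Rightarrow> real poly) \<Rightarrow> nat \<Rightarrow> (nat \<Rightarrow> real) \<Rightarrow> nat \<Rightarrow>
    (nat \<Rightarrow> real) \<Rightarrow> real poly" where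
  "Qpoly M P n x s \<gamma> =
     smult (sigma M P n) ((\<Prod>i=1..s. [:- \<gamma> i, 1:]) * (\<Prod>i=s+1..n. [:- x i, 1:]))"

end

theory Submission imports Defs begin

text \<open>Since \<open>Q\<^sub>n / \<sigma>\<^sub>n\<close> and \<open>P\<^sub>n\<close> are monic of degree \<open>n\<close>, their difference \<open>R\<close> has degree
  less than \<open>n\<close> and is orthogonal to \<open>P\<^sub>n\<close>; this gives \<open>f\<^sub>n = \<sigma>\<^sub>n\<^sup>2 \<L>[P\<^sub>n\<^sup>2] = 1\<close>. For \<open>i < n\<close> only
  \<open>f\<^sub>i = \<sigma>\<^sub>n \<L>[P\<^sub>i R] / \<parallel>P\<^sub>i\<parallel>\<close> survives, and any linear functional of \<open>R\<close> is \<open>O(\<epsilon>)\<close> because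
  a product of linear factors depends Lipschitz-continuously on its zeros.\<close>

lemma integrable_poly:
  assumes "moments_exist M"
  shows "integrable M (\<lambda>t. poly p t)"
  unfolding poly_altdef
  using assms by (intro Bochner_Integration.integrable_sum integrable_mult_right)
    (auto simp: moments_exist_def)

lemma Lfun_add: "moments_exist M \<Longrightarrow> Lfun M (p + q) = Lfun M p + Lfun M q"
  by (simp add: Lfun_def integrable_poly)

lemma Lfun_diff: "moments_exist M \<Longrightarrow> Lfun M (p - q) = Lfun M p - Lfun M q"
  by (simp add: Lfun_def integrable_poly)

lemma Lfun_smult: "Lfun M (smult c p) = c * Lfun M p"
  by (simp add: Lfun_def)

text \<open>If the integral vanished, \<open>p\<close> would be zero almost everywhere. The open set
  where \<open>p\<close> is nonzero would then be null and so miss the support, placing an infinite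
  support inside the finite zero set of \<open>p\<close>.\<close>

lemma Lfun_square_pos:
  assumes mom: "moments_exist M" and supp: "infinite (msupport M)" and "p \<noteq> 0"
  shows "Lfun M (p ^ 2) > 0"
proof (rule ccontr)
  assume "\<not> Lfun M (p ^ 2) > 0"
  moreover have "Lfun M (p ^ 2) \<ge> 0"
    by (simp add: Lfun_def)
  ultimately have "(\<integral>t. poly (p ^ 2) t \<partial>M) = 0"
    unfolding Lfun_def by linarith
  then have "AE t in M. poly (p ^ 2) t = 0"
    using integral_nonneg_eq_0_iff_AE[OF integrable_poly[OF mom, of "p ^ 2"]] by simp
  then have AE: "AE t in M. poly p t = 0"
    by simp
  let ?U = "{t. poly p t \<noteq> 0}"
  have "msupport M \<subseteq> {t. poly p t = 0}"
  proof
    fix t assume t: "t \<in> msupport M"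
    show "t \<in> {t. poly p t = 0}"
    proof (rule ccontr)
      assume "t \<notin> {t. poly p t = 0}"
      moreover have "open ?U"
        by (intro open_Collect_neq continuous_intros)
      ultimately have pos: "emeasure M (?U \<inter> space M) > 0"
        using t by (auto simp: msupport_def)
      have "(\<lambda>t. poly p t) \<in> borel_measurable M"
        using integrable_poly[OF mom] by (rule borel_measurable_integrable)
      then have "emeasure M {t \<in> space M. poly p t \<noteq> 0} = 0"
        using AE by (subst (asm) AE_iff_measurable[OF _ refl]) auto
      moreover have "{t \<in> space M. poly p t \<noteq> 0} = ?U \<inter> space M"
        by auto
      ultimately show False
        using pos by simp
    qed
  qed
  with supp poly_roots_finite[OF \<open>p \<noteq> 0\<close>] show False
    using finite_subset by blast
qed

text \<open>The leading terms cancel. Positivity of \<open>n\<close> covers equal polynomials, since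
  the zero polynomial has \<open>degree\<close> 0.\<close>

lemma degree_diff_monic_less:
  fixes p q :: "'a::comm_ring_1 poly"
  assumes "degree p = n" "degree q = n" "lead_coeff p = 1" "lead_coeff q = 1" "n > 0"
  shows "degree (p - q) < n"
proof (rule le_neq_implies_less)
  show "degree (p - q) \<le> n"
    using assms by (intro degree_diff_le) auto
  show "degree (p - q) \<noteq> n"
  proof
    assume eq: "degree (p - q) = n"
    then have "lead_coeff (p - q) = 0"
      using assms by simp
    then have "p - q = 0"
      by (simp only: leading_coeff_0_iff)
    with eq \<open>n > 0\<close> show False by simp
  qed
qed

text \<open>Strong induction on the degree: subtracting a multiple of the \<open>P\<close> of equal
  degree, itself orthogonal to \<open>P n\<close>, removes the leading term of
  \<open>q\<close>.\<close>

lemma Lfun_orthogonal_lower_degree: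
  assumes mom: "moments_exist M" and orth: "monic_orthogonal M P" and "degree q < n"
  shows "Lfun M (P n * q) = 0"
  using \<open>degree q < n\<close>
proof (induction "degree q" arbitrary: q rule: less_induct)
  case less
  let ?d = "degree q"
  define r where "r = q - smult (lead_coeff q) (P ?d)"
  have q: "P n * q = smult (lead_coeff q) (P n * P ?d) + P n * r"
    by (simp add: r_def algebra_simps)
  have P: "degree (P ?d) = ?d" "coeff (P ?d) ?d = 1" "Lfun M (P n * P ?d) = 0"
    using orth less.prems by (metis monic_orthogonal_def nat_neq_iff)+
  have "Lfun M (P n * r) = 0"
  \<comment> \<open>For a constant \<open>q\<close> the degree cannot drop further; there
    \<open>P 0\<close> is 1 and the remainder is zero.\<close>
  proof (cases "?d = 0")
    case True
    have "r = 0"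
    proof (rule poly_eqI)
      fix k
      show "coeff r k = coeff 0 k"
        using True P by (cases k) (auto simp: r_def coeff_eq_0)
    qed
    then show ?thesis by (simp add: Lfun_def)
  next
    case False
    have "degree r \<le> ?d"
      unfolding r_def using P by (intro degree_diff_le) auto
    moreover have "coeff r ?d = 0"
      using P by (simp add: r_def)
    ultimately have "degree r < ?d"
      using False by (metis degree_0 le_neq_implies_less leading_coeff_0_iff neq0_conv)
    then show ?thesis
      using less by simp
  qed
  then show ?case
    using P by (simp only: q Lfun_add[OF mom] Lfun_smult)
qed

lemma prod_linear_factors_lead:
  fixes x :: "nat \<Rightarrow> 'a::idom"
  shows "degree (\<Prod>i=1..n. [:- x i, 1:]) = n" and "lead_coeff (\<Prod>i=1..n. [:- x i, 1:]) = 1"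
  by (simp add: degree_prod_eq_sum_degree) (subst lead_coeff_prod, simp)

text \<open>One step of telescoping a difference of products. The factor X goes into the multiplier
  of \<open>A - B\<close>, while \<open>g\<close> and the small \<open>g - y\<close> become scalars
  that a linear functional can release.\<close>

lemma linear_factor_perturbation:
  fixes p A B :: "'a::comm_ring_1 poly"
  shows "p * ([:- g, 1:] * A - [:- y, 1:] * B) =
    (p * [:0, 1:]) * (A - B) - smult g (p * (A - B)) - smult (g - y) (p * B)"
proof -
  \<comment> \<open>Stated for abstract ring elements, so that normalisation does not meet the
    \<open>pCons\<close> form of the linear factors.\<close>
  have ring: "p * ((X - G) * A - (X - Y) * B) = (p * X) * (A - B) - G * (p * (A - B)) - (G - Y) * (p * B)"
    for X G Y :: "'a poly"
    by (simp add: algebra_simps)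
  have lin: "[:- c, 1:] = [:0, 1:] - [:c:]" for c :: 'a
    by simp
  have "smult c q = [:c:] * q" "[:g - y:] = [:g:] - [:y:]" for c and q :: "'a poly"
    by simp_all
  then show ?thesis
    by (simp only: lin[of g] lin[of y] ring)
qed

text \<open>The test polynomial \<open>p\<close> is arbitrary so that the induction can absorb the factor \<open>X\<close>.\<close>

lemma Lfun_prod_linear_factors_perturbation:
  fixes x :: "nat \<Rightarrow> real"
  assumes mom: "moments_exist M"
  shows "\<exists>K. \<forall>\<epsilon> \<gamma>. 0 < \<epsilon> \<and> \<epsilon> < 1 \<and> (\<forall>k\<in>{1..n}. \<bar>\<gamma> k - x k\<bar> < \<epsilon>) \<longrightarrow>
           \<bar>Lfun M (p * ((\<Prod>i=1..n. [:- \<gamma> i, 1:]) - (\<Prod>i=1..n. [:- x i, 1:])))\<bar> \<le> \<epsilon> * K"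
proof (induction n arbitrary: p)
  case 0
  show ?case by (intro exI[of _ 0]) (simp add: Lfun_def)
next
  case (Suc n)
  let ?A = "\<lambda>\<gamma>. \<Prod>i=1..n. [:- \<gamma> i, 1::real:]"
  obtain K1 where K1: "\<And>\<epsilon> \<gamma>. 0 < \<epsilon> \<Longrightarrow> \<epsilon> < 1 \<Longrightarrow> \<forall>k\<in>{1..n}. \<bar>\<gamma> k - x k\<bar> < \<epsilon> \<Longrightarrow>
      \<bar>Lfun M ((p * [:0, 1:]) * (?A \<gamma> - ?A x))\<bar> \<le> \<epsilon> * K1"
    using Suc.IH[of "p * [:0, 1:]"] by blast
  obtain K2 where K2: "\<And>\<epsilon> \<gamma>. 0 < \<epsilon> \<Longrightarrow> \<epsilon> < 1 \<Longrightarrow> \<forall>k\<in>{1..n}. \<bar>\<gamma> k - x k\<bar> < \<epsilon> \<Longrightarrow>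
      \<bar>Lfun M (p * (?A \<gamma> - ?A x))\<bar> \<le> \<epsilon> * K2"
    using Suc.IH[of p] by blast
  let ?x = "x (Suc n)"
  show ?case
  \<comment> \<open>The witness stays schematic until the final \<open>show\<close>; introduced
    before \<epsilon> and \<gamma>, it cannot depend on them.\<close>
  proof (intro exI allI impI)
    fix \<epsilon> :: real and \<gamma> :: "nat \<Rightarrow> real"
    assume h: "0 < \<epsilon> \<and> \<epsilon> < 1 \<and> (\<forall>k\<in>{1..Suc n}. \<bar>\<gamma> k - x k\<bar> < \<epsilon>)"
    let ?g = "\<gamma> (Suc n)"
    \<comment> \<open>Here \<epsilon> < 1 enters: it bounds the moved zero independently of
      \<epsilon> and \<gamma>.\<close>
    have g: "\<bar>?g - ?x\<bar> < \<epsilon>" "\<bar>?g\<bar> \<le> \<bar>?x\<bar> + 1"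
      using h by force+
    have top: "(\<Prod>i=1..Suc n. f i) = f (Suc n) * (\<Prod>i=1..n. f i)" for f :: "nat \<Rightarrow> real poly"
      by (simp add: prod.nat_ivl_Suc')
    have "p * ((\<Prod>i=1..Suc n. [:- \<gamma> i, 1:]) - (\<Prod>i=1..Suc n. [:- x i, 1:])) =
        (p * [:0, 1:]) * (?A \<gamma> - ?A x) - smult ?g (p * (?A \<gamma> - ?A x)) - smult (?g - ?x) (p * ?A x)"
      by (simp only: top linear_factor_perturbation)
    then have eq: "Lfun M (p * ((\<Prod>i=1..Suc n. [:- \<gamma> i, 1:]) - (\<Prod>i=1..Suc n. [:- x i, 1:]))) =
        Lfun M ((p * [:0, 1:]) * (?A \<gamma> - ?A x)) - ?g * Lfun M (p * (?A \<gamma> - ?A x))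
          - (?g - ?x) * Lfun M (p * ?A x)"
      by (simp only: Lfun_diff[OF mom] Lfun_smult)
    have "\<bar>Lfun M ((p * [:0, 1:]) * (?A \<gamma> - ?A x))\<bar> \<le> \<epsilon> * K1"
      using h by (intro K1) auto
    moreover have "\<bar>?g * Lfun M (p * (?A \<gamma> - ?A x))\<bar> \<le> (\<bar>?x\<bar> + 1) * (\<epsilon> * K2)"
      unfolding abs_mult using h g by (intro mult_mono K2) auto
    moreover have "\<bar>(?g - ?x) * Lfun M (p * ?A x)\<bar> \<le> \<epsilon> * \<bar>Lfun M (p * ?A x)\<bar>"
      unfolding abs_mult using g by (intro mult_right_mono) auto
    ultimately have "\<bar>Lfun M (p * ((\<Prod>i=1..Suc n. [:- \<gamma> i, 1:]) - (\<Prod>i=1..Suc n. [:- x i, 1:])))\<bar>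
        \<le> \<epsilon> * K1 + (\<bar>?x\<bar> + 1) * (\<epsilon> * K2) + \<epsilon> * \<bar>Lfun M (p * ?A x)\<bar>"
      unfolding eq by linarith
    then show "\<bar>Lfun M (p * ((\<Prod>i=1..Suc n. [:- \<gamma> i, 1:]) - (\<Prod>i=1..Suc n. [:- x i, 1:])))\<bar>
        \<le> \<epsilon> * (K1 + (\<bar>?x\<bar> + 1) * K2 + \<bar>Lfun M (p * ?A x)\<bar>)"
      by (simp add: algebra_simps)
  qed
qed

text \<open>The smallness of \<epsilon> is read as \<epsilon> < 1. Without a bound on \<omega> the
  claim for \<open>i < n\<close> would be trivial (divide by \<epsilon>); the content is that
  \<open>C\<close> is chosen before \<epsilon>, \<open>s\<close> and \<gamma>.\<close>

theorem theorem2p3: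
  fixes M :: "real measure" and a b :: ereal and P :: "nat \<Rightarrow> real poly"
    and n :: nat and x :: "nat \<Rightarrow> real"
  assumes "borel_measure_on a b M"
    and "infinite (msupport M)"
    and "moments_exist M"
    and "monic_orthogonal M P"
    and "P n = (\<Prod>k=1..n. [:- x k, 1:])"
  shows "\<exists>C::real. \<forall>(\<epsilon>::real) (s::nat) (\<gamma>::nat \<Rightarrow> real).
           0 < \<epsilon> \<and> \<epsilon> < 1 \<and> s \<in> {1..n - 1} \<and> (\<forall>k\<in>{1..s}. \<bar>\<gamma> k - x k\<bar> < \<epsilon>) \<longrightarrow>
           (\<exists>\<omega>::nat \<Rightarrow> real. (\<forall>i<n. \<bar>\<omega> i\<bar> \<le> C) \<and>
              (\<forall>i\<le>n. Lfun M (Ptilde M P i * Qpoly M P n x s \<gamma>) = (if i < n then \<epsilon> * \<omega> i else 1)))"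
proof -
  note mom = assms(3) and orth = assms(4) and Pn = assms(5)
  let ?A = "\<lambda>\<gamma>. \<Prod>i=1..n. [:- \<gamma> i, 1::real:]"
  \<comment> \<open>Both normalising factors are put into the test polynomial, leaving only the
    monic difference to be perturbed.\<close>
  let ?p = "\<lambda>i. smult (sigma M P n) (Ptilde M P i)"
  have "\<forall>i. \<exists>K. \<forall>\<epsilon> \<gamma>. 0 < \<epsilon> \<and> \<epsilon> < 1 \<and> (\<forall>k\<in>{1..n}. \<bar>\<gamma> k - x k\<bar> < \<epsilon>) \<longrightarrow>
      \<bar>Lfun M (?p i * (?A \<gamma> - ?A x))\<bar> \<le> \<epsilon> * K"
    by (intro allI Lfun_prod_linear_factors_perturbation mom)
  from choice[OF this] obtain K where K: "\<forall>i \<epsilon> \<gamma>. 0 < \<epsilon> \<and> \<epsilon> < 1 \<and> (\<forall>k\<in>{1..n}. \<bar>\<gamma> k - x k\<bar> < \<epsilon>) \<longrightarrow>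
      \<bar>Lfun M (?p i * (?A \<gamma> - ?A x))\<bar> \<le> \<epsilon> * K i"
    by (elim exE)
  \<comment> \<open>Positivity of the squared norm matters here: with a zero norm,
    \<open>sigma\<close> would be 0 by the convention for division.\<close>
  have norm: "sigma M P n * sigma M P n * Lfun M (P n * P n) = 1"
  proof -
    have "P n \<noteq> 0"
      using orth by (metis monic_orthogonal_def leading_coeff_0_iff zero_neq_one)
    then have "Lfun M (P n ^ 2) > 0"
      by (rule Lfun_square_pos[OF mom assms(2)])
    then show ?thesis
      by (simp add: sigma_def Lnorm_def power2_eq_square)
  qed
  show ?thesis
  \<comment> \<open>A single constant serving all indices; \<open>K\<close> was fixed before
    \<epsilon>, \<open>s\<close> and \<gamma>.\<close>
  proof (rule exI[of _ "Max (K ` {..n})"], intro allI impI)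
    fix \<epsilon> :: real and s :: nat and \<gamma> :: "nat \<Rightarrow> real"
    assume h: "0 < \<epsilon> \<and> \<epsilon> < 1 \<and> s \<in> {1..n - 1} \<and> (\<forall>k\<in>{1..s}. \<bar>\<gamma> k - x k\<bar> < \<epsilon>)"
    \<comment> \<open>Padding with the exact zeros makes all \<open>n\<close> zeros count as
      perturbed, so one bound serves every \<open>s\<close>.\<close>
    define \<gamma>' where "\<gamma>' k = (if k \<le> s then \<gamma> k else x k)" for k
    define R where "R = ?A \<gamma>' - ?A x"
    have close: "\<forall>k\<in>{1..n}. \<bar>\<gamma>' k - x k\<bar> < \<epsilon>"
      using h by (auto simp: \<gamma>'_def)
    have split: "{1..n} = {1..s} \<union> {s+1..n}"
      using h by auto
    have "?A \<gamma>' = (\<Prod>i=1..s. [:- \<gamma>' i, 1:]) * (\<Prod>i=s+1..n. [:- \<gamma>' i, 1:])"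
      unfolding split by (rule prod.union_disjoint) auto
    also have "\<dots> = (\<Prod>i=1..s. [:- \<gamma> i, 1:]) * (\<Prod>i=s+1..n. [:- x i, 1:])"
      by (intro arg_cong2[of _ _ _ _ "(*)"] prod.cong) (auto simp: \<gamma>'_def)
    finally have Q: "Qpoly M P n x s \<gamma> = smult (sigma M P n) (P n + R)"
      by (simp add: Qpoly_def R_def Pn)
    have expand: "Lfun M (Ptilde M P i * Qpoly M P n x s \<gamma>) =
        sigma M P n * sigma M P i * Lfun M (P i * P n) + Lfun M (?p i * R)" for i
      by (simp add: Q Ptilde_def Lfun_smult Lfun_add[OF mom] distrib_left)
    \<comment> \<open>The range of \<open>s\<close> is nonempty only for \<open>n\<close> at least
      2, which supplies \<open>n > 0\<close>.\<close>
    have "degree R < n"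
      unfolding R_def using h
      by (intro degree_diff_monic_less prod_linear_factors_lead) auto
    then have "Lfun M (?p n * R) = 0"
      by (simp add: Ptilde_def Lfun_smult Lfun_orthogonal_lower_degree[OF mom orth])
    then have top: "Lfun M (Ptilde M P n * Qpoly M P n x s \<gamma>) = 1"
      using expand[of n] norm by simp
    \<comment> \<open>For \<open>i < n\<close> the main term vanishes by orthogonality, so \<omega>
      at \<open>i\<close> is the perturbation term divided by \<epsilon>.\<close>
    have low: "Lfun M (Ptilde M P i * Qpoly M P n x s \<gamma>) = \<epsilon> * (Lfun M (?p i * R) / \<epsilon>)"
      if "i < n" for i
    proof -
      have "Lfun M (P i * P n) = 0"
        using orth that by (auto simp: monic_orthogonal_def)
      then show ?thesis
        using expand[of i] h by simp
    qed
    have "\<bar>Lfun M (?p i * R) / \<epsilon>\<bar> \<le> Max (K ` {..n})" if "i < n" for i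
    proof -
      have "\<bar>Lfun M (?p i * R)\<bar> \<le> \<epsilon> * K i"
        unfolding R_def using h close K by blast
      then have "\<bar>Lfun M (?p i * R) / \<epsilon>\<bar> \<le> K i"
        using h by (simp add: abs_divide pos_divide_le_eq mult.commute)
      also have "\<dots> \<le> Max (K ` {..n})"
        using that by (intro Max_ge) auto
      finally show ?thesis .
    qed
    moreover have "Lfun M (Ptilde M P i * Qpoly M P n x s \<gamma>) =
        (if i < n then \<epsilon> * (Lfun M (?p i * R) / \<epsilon>) else 1)" if "i \<le> n" for i
      using low[of i] top that by (cases "i = n") (simp_all only: le_less if_True if_False less_irrefl simp_thms)
    ultimately show "\<exists>\<omega>::nat \<Rightarrow> real. (\<forall>i<n. \<bar>\<omega> i\<bar> \<le> Max (K ` {..n})) \<and>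
        (\<forall>i\<le>n. Lfun M (Ptilde M P i * Qpoly M P n x s \<gamma>) = (if i < n then \<epsilon> * \<omega> i else 1))"
      by (intro exI[of _ "\<lambda>i. Lfun M (?p i * R) / \<epsilon>"]) blast
  qed
qed

end
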